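(* For every $\beta>0$ there exists a constant $C_2(\beta)\in(0,\infty)$ such that for all real $p\ge 2$ with $p\ge 2\beta$, $$B(p,\beta)^{1/p}\ \ge\ \frac{p}{e\,\ln(p/\beta)}\cdot\left[1-C_2(\beta)\cdot\frac{\ln\ln(p/\beta)}{\ln(p/\beta)}\right].$$
   Context: The Bell function of two variables is $B(p,\beta)=e^{-\beta}\sum_{k=0}^{\infty}\frac{k^p\,\beta^k}{k!}$ for real $p\ge 2$ and $\beta>0$. Equivalently, $B(p,\beta)={\bf E}(\tau^p)$ where $\tau$ is a Poisson random variable with parameter $\beta$. Here $\ln$ is the natural logarithm. *)

theory Defs
  imports "HOL-Analysis.Analysis"
begin

(* The term k = 0 vanishes because 0 powr p = 0, in accordance with 0^p = 0 for p > 0. *)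
definition bell_fun :: "real \<Rightarrow> real \<Rightarrow> real" where
  "bell_fun p \<beta> = exp (- \<beta>) * (\<Sum>k. real k powr p * \<beta> ^ k / fact k)"

end

theory Submission
  imports Defs
begin

text \<open>Since \<open>k ^ p / k! = (k ^ (p - 1)) / (k - 1)!\<close>, the Poisson moment equals \<open>\<beta>\<close> times the mean of
  \<open>(\<tau> + 1) powr (p - 1)\<close>.  Rewriting this as a mean over a Poisson variable with parameter \<open>l\<close>
  and applying Jensen's inequality to \<open>exp\<close>, together with \<open>E (ln (\<tau> + 1)) \<ge> ln l\<close> (which follows
  from \<open>E (1 / (\<tau> + 1)) \<le> 1 / l\<close>), gives a lower bound for every \<open>l > 0\<close>.  With \<open>r = p / \<beta>\<close>, the
  choice \<open>l = \<beta> * r / ln r\<close> serves for \<open>r \<ge> e\<close> and \<open>l = 2 * \<beta>\<close> for \<open>2 \<le> r \<le> e\<close>.\<close>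

section \<open>The exponential series and convergence of the moment series\<close>

lemma powr_le_exp:
  fixes p y :: real
  assumes "p > 0" "y \<ge> 0"
  shows "y powr p \<le> p powr p * exp y"
proof -
  have "y / p \<le> exp (y / p)"
    using exp_ge_add_one_self[of "y / p"] by linarith
  then have "y \<le> p * exp (y / p)"
    using assms by (simp add: field_simps)
  then have "y powr p \<le> (p * exp (y / p)) powr p"
    using assms by (intro powr_mono2) auto
  also have "\<dots> = p powr p * exp y"
    using assms by (simp add: powr_mult exp_powr_real)
  finally show ?thesis .
qed

lemma exp_series_sums: "(\<lambda>k. x ^ k / fact k) sums exp (x :: real)"
  using exp_converges[of x] by (simp add: scaleR_conv_of_real divide_inverse mult.commute)

lemma exp_series_weighted_sums:
  "(\<lambda>k. real k * (x ^ k / fact k)) sums (x * exp (x :: real))"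
proof -
  have "(\<lambda>k. real (Suc k) * (x ^ Suc k / fact (Suc k))) = (\<lambda>k. x * (x ^ k / fact k))"
    by (simp add: fun_eq_iff del: of_nat_Suc)
  then have "(\<lambda>k. real (Suc k) * (x ^ Suc k / fact (Suc k))) sums (x * exp x)"
    using sums_mult[OF exp_series_sums, of x x] by simp
  from sums_Suc[OF this] show ?thesis by simp
qed

text \<open>An unnormalised Poisson mean of \<open>x / (k + 1)\<close>: dividing by
  \<open>k + 1\<close> shifts the exponential series by one index, and the missing constant term
  accounts for the \<open>- 1\<close>.\<close>

lemma exp_series_shifted_sums:
  "(\<lambda>k. x / real (Suc k) * (x ^ k / fact k)) sums (exp (x :: real) - 1)"
proof -
  have "(\<lambda>k. x / real (Suc k) * (x ^ k / fact k)) = (\<lambda>k. x ^ Suc k / fact (Suc k))"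
    by (auto simp: fun_eq_iff field_simps)
  then show ?thesis
    using exp_series_sums[of x] sums_Suc_iff[of "\<lambda>k. x ^ k / fact k" "exp x - 1"] by simp
qed

text \<open>Bounding \<open>k powr p\<close> by a multiple of \<open>exp k\<close> leaves an
  exponential series with parameter \<open>exp 1 * \<beta>\<close>.\<close>

lemma summable_bell:
  fixes p \<beta> :: real
  assumes "p > 0" "\<beta> > 0"
  shows "summable (\<lambda>k. real k powr p * \<beta> ^ k / fact k)"
proof (rule summable_comparison_test')
  show "summable (\<lambda>k. p powr p * ((exp 1 * \<beta>) ^ k / fact k))"
    using exp_series_sums sums_summable by (intro summable_mult) blast
next
  fix k :: nat
  have "real k powr p \<le> p powr p * exp (real k)"
    using assms by (intro powr_le_exp) auto
  then have "real k powr p * (\<beta> ^ k / fact k) \<le> p powr p * exp (real k) * (\<beta> ^ k / fact k)"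
    using assms by (intro mult_right_mono) auto
  also have "\<dots> = p powr p * ((exp 1 * \<beta>) ^ k / fact k)"
    by (simp add: power_mult_distrib exp_of_nat_mult[symmetric])
  finally show "norm (real k powr p * \<beta> ^ k / fact k) \<le> p powr p * ((exp 1 * \<beta>) ^ k / fact k)"
    using assms by simp
qed

section \<open>Lower bounds with a free Poisson parameter\<close>

lemma bell_fun_ge_tilted:
  fixes p \<beta> l :: real
  assumes p: "p \<ge> 1" and \<beta>: "\<beta> > 0" and l: "l > 0"
  shows "bell_fun p \<beta> \<ge> \<beta> * exp (l - \<beta> + (p - 1) * ln l + l * ln (\<beta> / l))"
proof -
  define F where "F k = real k powr p * \<beta> ^ k / fact k" for k :: nat
  define m where "m = (p - 1) * ln l + l * ln (\<beta> / l)"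
  define a where "a = 1 + (p - 1) * (ln l + 1) - m"
  define w where "w k = l ^ k / fact k" for k :: nat
  define H where "H k = exp m * \<beta> * (a * w k - (p - 1) * (l / real (Suc k) * w k)
      + ln (\<beta> / l) * (real k * w k))" for k :: nat
  have F: "summable F"
    unfolding F_def using p \<beta> by (intro summable_bell) auto
  have H: "H sums (exp m * \<beta> * (a * exp l - (p - 1) * (exp l - 1) + ln (\<beta> / l) * (l * exp l)))"
    unfolding H_def w_def
    by (intro sums_mult sums_add sums_diff exp_series_sums exp_series_weighted_sums
        exp_series_shifted_sums)
  \<comment> \<open>\<open>H k\<close> comes from \<open>exp (y - m) \<ge> 1 + (y - m)\<close>, where \<open>m\<close> is the lower bound for the
    mean exponent, and \<open>ln (k + 1) \<ge> ln l + 1 - l / (k + 1)\<close>.\<close>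
  have le: "H k \<le> F (Suc k)" for k
  proof -
    define y where "y = (p - 1) * ln (real (Suc k)) + real k * ln (\<beta> / l)"
    have "ln (l / real (Suc k)) \<le> l / real (Suc k) - 1"
      using l by (intro ln_le_minus_one) auto
    then have "ln l + 1 - l / real (Suc k) \<le> ln (real (Suc k))"
      using l by (subst (asm) ln_div) auto
    then have "(p - 1) * (ln l + 1 - l / real (Suc k)) \<le> (p - 1) * ln (real (Suc k))"
      using p by (intro mult_left_mono) auto
    then have "a - (p - 1) * (l / real (Suc k)) + real k * ln (\<beta> / l) \<le> 1 + (y - m)"
      unfolding a_def y_def by (simp add: algebra_simps)
    also have "\<dots> \<le> exp (y - m)"
      by (rule exp_ge_add_one_self)
    finally have "exp m * \<beta> * w k * (a - (p - 1) * (l / real (Suc k)) + real k * ln (\<beta> / l))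
        \<le> exp m * \<beta> * w k * exp (y - m)"
      using \<beta> l by (intro mult_left_mono) (auto simp: w_def)
    moreover have "exp m * \<beta> * w k * (a - (p - 1) * (l / real (Suc k)) + real k * ln (\<beta> / l)) = H k"
      unfolding H_def by (simp add: algebra_simps)
    moreover have "exp m * \<beta> * w k * exp (y - m) = F (Suc k)"
    proof -
      have "exp m * exp (y - m) = exp y"
        by (simp add: exp_add[symmetric])
      also have "exp y = real (Suc k) powr (p - 1) * (\<beta> / l) ^ k"
        unfolding y_def using \<beta> l by (simp add: exp_add powr_def exp_of_nat_mult)
      finally have "exp m * \<beta> * w k * exp (y - m)
          = real (Suc k) powr (p - 1) * (\<beta> / l) ^ k * \<beta> * w k"
        by (simp add: mult_ac)
      also have "\<dots> = real (Suc k) powr (p - 1) * \<beta> ^ Suc k / fact k"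
        unfolding w_def using l by (simp add: power_divide)
      also have "real (Suc k) powr (p - 1) = real (Suc k) powr p / real (Suc k)"
        by (simp add: powr_diff)
      finally show ?thesis
        unfolding F_def by (simp add: field_simps)
    qed
    ultimately show ?thesis by simp
  qed
  \<comment> \<open>The deviation from \<open>m\<close> averages to zero up to the surplus
    \<open>p - 1\<close>, which comes from the \<open>- 1\<close> in the shifted series and is
    nonnegative.\<close>
  have "a * exp l - (p - 1) * (exp l - 1) + ln (\<beta> / l) * (l * exp l) = exp l + (p - 1)"
    unfolding a_def m_def by (simp add: algebra_simps)
  then have "suminf H = exp m * \<beta> * (exp l + (p - 1))"
    using sums_unique[OF H] by simp
  then have "exp m * \<beta> * exp l \<le> suminf H"
    using p \<beta> by simp
  also have "\<dots> \<le> (\<Sum>k. F (Suc k))"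
    using le sums_summable[OF H] F by (intro suminf_le) (auto simp: summable_Suc_iff)
  also have "\<dots> = suminf F"
    using suminf_split_head[OF F] by (simp add: F_def)
  finally have "exp (- \<beta>) * (exp m * \<beta> * exp l) \<le> bell_fun p \<beta>"
    unfolding bell_fun_def F_def by (intro mult_left_mono) auto
  moreover have "exp (- \<beta>) * (exp m * \<beta> * exp l) = \<beta> * exp (l - \<beta> + m)"
    by (simp add: exp_add exp_diff exp_minus field_simps)
  ultimately show ?thesis
    unfolding m_def by (simp add: add.assoc)
qed

text \<open>Take \<open>l = \<beta> * x\<close>. The prefactor \<open>\<beta>\<close> and the term
  \<open>(p - 1) * ln \<beta>\<close> combine to \<open>\<beta> powr p\<close>, whose root is the
  factor \<open>\<beta>\<close>.\<close>

lemma bell_fun_root_ge: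
  fixes p \<beta> x :: real
  assumes p: "p \<ge> 1" and \<beta>: "\<beta> > 0" and x: "x > 0"
  shows "bell_fun p \<beta> powr (1 / p) \<ge> \<beta> * exp (((p - 1) * ln x + \<beta> * (x - 1 - x * ln x)) / p)"
proof -
  let ?E = "(p - 1) * ln x + \<beta> * (x - 1 - x * ln x)"
  have "\<beta> * x - \<beta> + (p - 1) * ln (\<beta> * x) + \<beta> * x * ln (\<beta> / (\<beta> * x)) = ?E + (p - 1) * ln \<beta>"
    using \<beta> x by (simp add: ln_mult ln_div algebra_simps)
  moreover have "\<beta> * exp (?E + (p - 1) * ln \<beta>) = exp (?E + p * ln \<beta>)"
  proof -
    have "?E + p * ln \<beta> = ln \<beta> + (?E + (p - 1) * ln \<beta>)"
      by (simp add: algebra_simps)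
    then show ?thesis using \<beta> by (simp only: exp_add exp_ln)
  qed
  ultimately have "exp (?E + p * ln \<beta>) \<le> bell_fun p \<beta>"
    using bell_fun_ge_tilted[OF p \<beta>, of "\<beta> * x"] \<beta> x by simp
  then have "exp (?E + p * ln \<beta>) powr (1 / p) \<le> bell_fun p \<beta> powr (1 / p)"
    using p by (intro powr_mono2) auto
  moreover have "exp (?E + p * ln \<beta>) powr (1 / p) = exp (ln \<beta> + ?E / p)"
    using p by (simp add: exp_powr_real add_divide_distrib)
  ultimately show ?thesis
    using \<beta> by (simp add: exp_add)
qed

text \<open>With \<open>\<beta> = p * exp (- L)\<close> the target factor
  \<open>p / (exp 1 * L)\<close> splits off, and \<open>exp z \<ge> 1 + z\<close> makes the rest
  linear; this reduces the claim to a condition on exponents.\<close>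

lemma bell_fun_root_ge_ln:
  fixes p \<beta> x :: real
  defines "L \<equiv> ln (p / \<beta>)"
  assumes p: "p \<ge> 1" and \<beta>: "\<beta> > 0" and x: "x > 0" and L: "L > 0"
    and t: "t \<le> 2 + ln L - L + ((p - 1) * ln x + \<beta> * (x - 1 - x * ln x)) / p"
  shows "bell_fun p \<beta> powr (1 / p) \<ge> p / (exp 1 * L) * t"
proof -
  let ?D = "((p - 1) * ln x + \<beta> * (x - 1 - x * ln x)) / p"
  have "exp (1 + ln L - L) = exp 1 * L * (\<beta> / p)"
    using p \<beta> L unfolding L_def by (simp add: exp_add exp_diff)
  then have "p / (exp 1 * L) * exp (1 + ln L - L + ?D) = \<beta> * exp ?D"
    using p L by (simp add: exp_add)
  moreover have "t \<le> exp (1 + ln L - L + ?D)"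
    using t exp_ge_add_one_self[of "1 + ln L - L + ?D"] by linarith
  then have "p / (exp 1 * L) * t \<le> p / (exp 1 * L) * exp (1 + ln L - L + ?D)"
    using p L by (intro mult_left_mono) auto
  ultimately show ?thesis
    using bell_fun_root_ge[OF p \<beta> x] by simp
qed

section \<open>Choices of the parameter for large and small \<open>p / \<beta>\<close>\<close>

text \<open>Here \<open>x = (p / \<beta>) / ln (p / \<beta>)\<close> approximates the maximiser of the exponent,
  which solves \<open>x * ln x = p / \<beta>\<close> up to lower-order terms.\<close>
lemma bell_fun_root_ge_large:
  fixes p \<beta> :: real
  defines "L \<equiv> ln (p / \<beta>)"
  assumes p: "p \<ge> 1" and \<beta>: "\<beta> > 0" and L: "L > 0"
    and t: "t \<le> 1 + (1 + ln L) / L - (L - ln L) / p - \<beta> / p"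
  shows "bell_fun p \<beta> powr (1 / p) \<ge> p / (exp 1 * L) * t"
proof -
  define x where "x = p / \<beta> / L"
  have x: "x > 0" using p \<beta> L by (simp add: x_def)
  have lnx: "ln x = L - ln L"
    unfolding x_def using p \<beta> L by (subst ln_div) (auto simp: L_def)
  have bx: "\<beta> * x = p / L" using \<beta> by (simp add: x_def)
  have "(p - 1) * ln x + \<beta> * (x - 1 - x * ln x)
      = (p - 1) * ln x + (\<beta> * x - \<beta> - \<beta> * x * ln x)"
    by (simp add: algebra_simps)
  also have "\<dots> / p = (L - ln L) - (L - ln L) / p + 1 / L - \<beta> / p - (L - ln L) / L"
    unfolding bx lnx using p L by (simp add: field_simps)
  also have "\<dots> = (L - ln L) - (L - ln L) / p + (1 + ln L) / L - \<beta> / p - 1"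
    using L by (simp add: field_simps)
  finally have "t \<le> 2 + ln L - L + ((p - 1) * ln x + \<beta> * (x - 1 - x * ln x)) / p"
    using t by linarith
  then show ?thesis
    using bell_fun_root_ge_ln[OF p \<beta> x] L unfolding L_def by blast
qed

text \<open>Taylor expansion at 1 rather than 0: its factor \<open>exp 1\<close> matches the bound
  \<open>1 / \<beta> \<le> exp 1 / 2\<close> in the next lemma.\<close>

lemma exp_ge_quadratic_at_one:
  fixes y :: real
  assumes "y \<ge> 1"
  shows "exp y \<ge> exp 1 * (y\<^sup>2 + 1) / 2"
proof -
  have "1 + (y - 1) + (y - 1)\<^sup>2 / 2 \<le> exp (y - 1)"
    using assms exp_lower_Taylor_quadratic[of "y - 1"] by simp
  then have "exp 1 * (1 + (y - 1) + (y - 1)\<^sup>2 / 2) \<le> exp 1 * exp (y - 1)"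
    by simp
  also have "\<dots> = exp y" by (simp add: exp_add[symmetric])
  also have "exp 1 * (1 + (y - 1) + (y - 1)\<^sup>2 / 2) = exp 1 * (y\<^sup>2 + 1) / 2"
    by (simp add: power2_eq_square field_simps)
  finally show ?thesis .
qed

text \<open>For \<open>\<beta> \<ge> 2 / e\<close> the range of \<open>p / \<beta>\<close> reaches below \<open>e\<close>, where \<open>ln (ln (p / \<beta>))\<close> is
  negative and a large constant would make the claim stronger.  So there the constant must be
  small, and the bound without any correction term is needed for \<open>p / \<beta> \<ge> e\<close>.\<close>
lemma bell_fun_root_ge_no_correction:
  fixes p \<beta> :: real
  assumes p: "p \<ge> 1" and \<beta>: "\<beta> \<ge> 2 / exp 1" and L: "ln (p / \<beta>) \<ge> 1"
  shows "bell_fun p \<beta> powr (1 / p) \<ge> p / (exp 1 * ln (p / \<beta>))"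
proof -
  define L where "L = ln (p / \<beta>)"
  define E :: real where "E = exp 1"
  have E: "E \<ge> 2" using exp_ge_add_one_self[of "1::real"] by (simp add: E_def)
  have L1: "L \<ge> 1" using L by (simp add: L_def)
  have \<beta>0: "\<beta> > 0" using \<beta> by (rule less_le_trans[rotated]) simp
  have r: "p / \<beta> = exp L" using p \<beta>0 by (simp add: L_def)
  have p': "p = \<beta> * exp L" using r \<beta>0 by (simp add: field_simps)
  have lnL: "0 \<le> ln L" "1 - 1 / L \<le> ln L" "ln L \<le> L"
    using L1 ln_le_minus_one[of "1 / L"] ln_le_minus_one[of L] by (auto simp: ln_div)
  have "1 / \<beta> \<le> E / 2" using \<beta> \<beta>0 by (simp add: E_def field_simps)
  then have "(L - ln L) * (1 / \<beta>) \<le> (L - ln L) * (E / 2)"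
    using lnL by (intro mult_left_mono) auto
  then have "(L - ln L) * (1 / \<beta>) + 1 \<le> (L - ln L) * (E / 2) + 1" by simp
  \<comment> \<open>The terms \<open>E * L * L / 2\<close> cancel; since \<open>E \<ge> 2\<close>,
    what remains follows from \<open>L \<le> 1 + L * ln L\<close>.\<close>
  also have "\<dots> * L \<le> (1 + ln L) * (E * (L\<^sup>2 + 1) / 2)"
  proof -
    have "L - 1 \<le> ln L * L"
      using mult_right_mono[OF lnL(2), of L] L1 by (simp add: left_diff_distrib)
    moreover have "ln L * L \<le> ln L * (E * (L\<^sup>2 + 1) / 2)"
    proof -
      have "2 * (L\<^sup>2 + 1) \<le> E * (L\<^sup>2 + 1)" using E by (intro mult_right_mono) auto
      moreover have "2 * L \<le> L\<^sup>2 + 1" using sum_squares_bound[of L 1] by simp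
      ultimately show ?thesis using lnL L1 by (intro mult_left_mono) auto
    qed
    moreover have "0 \<le> ln L * L * E" using lnL L1 E by simp
    ultimately show ?thesis using E by (simp add: power2_eq_square field_simps)
  qed
  also have "\<dots> \<le> (1 + ln L) * exp L"
    using exp_ge_quadratic_at_one[OF L1] lnL by (intro mult_left_mono) (auto simp: E_def)
  finally have "((L - ln L) * (1 / \<beta>) + 1) * L \<le> (1 + ln L) * exp L"
    using L1 by (simp add: mult_right_mono)
  then have "((L - ln L) * (1 / \<beta>) + 1) / exp L \<le> (1 + ln L) / L"
    using L1 by (simp add: pos_divide_le_eq pos_le_divide_eq)
  moreover have "((L - ln L) * (1 / \<beta>) + 1) / exp L = (L - ln L) / p + \<beta> / p"
    unfolding p' using \<beta>0 by (simp add: field_simps)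
  ultimately have "1 \<le> 1 + (1 + ln L) / L - (L - ln L) / p - \<beta> / p" by linarith
  then show ?thesis
    using bell_fun_root_ge_large[OF p \<beta>0, of 1] L1 unfolding L_def by simp
qed

text \<open>Numerical bounds on logarithms: the quadratic Taylor bound is sharp enough at
  \<open>x / 4\<close>, and its fourth power bounds \<open>exp x\<close>.\<close>

lemma ln_le_by_quadratic:
  fixes x y :: real
  assumes "x \<ge> 0" "y > 0" "y \<le> (1 + x / 4 + (x / 4)\<^sup>2 / 2) ^ 4"
  shows "ln y \<le> x"
proof -
  have "(1 + x / 4 + (x / 4)\<^sup>2 / 2) ^ 4 \<le> exp (x / 4) ^ 4"
    using assms exp_lower_Taylor_quadratic[of "x / 4"] by (intro power_mono) auto
  also have "\<dots> = exp x" by (simp add: exp_of_nat_mult[symmetric])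
  finally have "y \<le> exp x" using assms by linarith
  then show ?thesis using assms ln_mono[of y "exp x"] by simp
qed

text \<open>The choice \<open>x = 2\<close> gains a fixed surplus over 1, which leaves room for a
  positive constant where \<open>ln (ln (p / \<beta>))\<close> is negative.\<close>

lemma bell_fun_root_ge_small:
  fixes p \<beta> :: real
  assumes p: "p \<ge> 2" and \<beta>: "\<beta> > 0" "p \<ge> 2 * \<beta>" and L: "ln (p / \<beta>) \<le> 1"
  shows "bell_fun p \<beta> powr (1 / p) \<ge> p / (exp 1 * ln (p / \<beta>)) * (1 + 1 / 20)"
proof -
  define L where "L = ln (p / \<beta>)"
  have "ln 2 \<le> L" unfolding L_def using p \<beta> by (simp add: field_simps)
  then have L23: "2 / 3 \<le> L" using ln2_ge_two_thirds by linarith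
  have L1: "L \<le> 1" using L by (simp add: L_def)
  have ln2: "ln 2 \<le> (7 / 10 :: real)"
    by (rule ln_le_by_quadratic) (auto simp: power2_eq_square power4_eq_xxxx)
  have ln32: "ln (3 / 2) \<le> (42 / 100 :: real)"
    by (rule ln_le_by_quadratic) (auto simp: power2_eq_square power4_eq_xxxx)
  \<comment> \<open>\<open>ln L - L\<close> increases on \<open>(0, 1]\<close>, so its value at
    \<open>L = 2 / 3\<close> is the lower bound sought.\<close>
  have "ln (2 / (3 * L)) \<le> 2 / (3 * L) - 1"
    using L23 by (intro ln_le_minus_one) auto
  moreover have "ln (2 / (3 * L)) = - ln (3 / 2) - ln L"
    using L23 by (simp add: ln_div ln_mult)
  moreover have "1 - 2 / (3 * L) \<ge> L - 2 / 3"
  proof -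
    have "(L - 2 / 3) * L \<le> (L - 2 / 3) * 1"
      using L23 L1 by (intro mult_left_mono) auto
    then show ?thesis using L23 by (simp add: field_simps)
  qed
  ultimately have lnL: "ln L - L \<ge> - (42 / 100) - 2 / 3" using ln32 by linarith
  \<comment> \<open>Equality holds at \<open>p = 2\<close>, \<open>\<beta> = 1\<close>; the
    difference is a combination of \<open>p - 2\<close> and \<open>p - 2 * \<beta>\<close> with
    nonnegative coefficients.\<close>
  have "p * (1 / 2 - ln 2 / 2) \<le> (p - 1) * ln 2 + \<beta> * (2 - 1 - 2 * ln 2)"
  proof -
    have "0 \<le> (p - 2) / 2 * ln 2 + (p - 2 * \<beta>) / 2 * (2 * ln 2 - 1)"
      using p \<beta> ln2_ge_two_thirds by (intro add_nonneg_nonneg mult_nonneg_nonneg) auto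
    also have "\<dots> = (p - 1) * ln 2 + \<beta> * (2 - 1 - 2 * ln 2) - p * (1 / 2 - ln 2 / 2)"
      by (simp add: field_simps)
    finally show ?thesis by simp
  qed
  then have "1 / 2 - ln 2 / 2 \<le> ((p - 1) * ln 2 + \<beta> * (2 - 1 - 2 * ln 2)) / p"
    using p by (simp add: pos_le_divide_eq mult.commute)
  \<comment> \<open>Numerically,
    \<open>2 - 42 / 100 - 2 / 3 + 1 / 2 - 7 / 20 > 1 + 1 / 20\<close>.\<close>
  then have "1 + 1 / 20 \<le> 2 + ln L - L + ((p - 1) * ln 2 + \<beta> * (2 - 1 - 2 * ln 2)) / p"
    using lnL ln2 by linarith
  then show ?thesis
    using bell_fun_root_ge_ln[of p \<beta> 2 "1 + 1 / 20"] p \<beta> L23 unfolding L_def by simp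
qed

theorem mainTheorem2:
  fixes \<beta> :: real
  assumes "\<beta> > 0"
  shows "\<exists>C\<^sub>2 :: real. C\<^sub>2 > 0 \<and>
    (\<forall>p::real. p \<ge> 2 \<and> p \<ge> 2 * \<beta> \<longrightarrow>
      bell_fun p \<beta> powr (1 / p) \<ge>
        p / (exp 1 * ln (p / \<beta>)) * (1 - C\<^sub>2 * (ln (ln (p / \<beta>)) / ln (p / \<beta>))))"
proof (cases "\<beta> \<ge> 2 / exp 1")
  case True
  have "p / (exp 1 * ln (p / \<beta>)) * (1 - 1 / 20 * (ln (ln (p / \<beta>)) / ln (p / \<beta>)))
      \<le> bell_fun p \<beta> powr (1 / p)" if p: "p \<ge> 2" "p \<ge> 2 * \<beta>" for p
  proof -
    define L where "L = ln (p / \<beta>)"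
    have "ln 2 \<le> L" unfolding L_def using p assms by (simp add: field_simps)
    then have L23: "2 / 3 \<le> L" using ln2_ge_two_thirds by linarith
    \<comment> \<open>The constant \<open>1 / 20\<close> is the surplus available for
      \<open>L < 1\<close>: there \<open>- ln L / L \<le> 1\<close>, so the correction never exceeds
      it. For \<open>L \<ge> 1\<close> the correction only lowers the claim.\<close>
    define b where "b = (if L \<ge> 1 then 1 else 1 + 1 / 20 :: real)"
    have "1 - 1 / 20 * (ln L / L) \<le> b"
    proof (cases "L \<ge> 1")
      case False
      have "2 / 3 * (2 / 3) \<le> L * L" using L23 by (intro mult_mono) auto
      then have "1 / L - 1 \<le> L" using L23 False by (simp add: field_simps)
      then have "- ln L \<le> L"
        using ln_le_minus_one[of "1 / L"] L23 by (simp add: ln_div)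
      then have "- (ln L / L) \<le> 1" using L23 by (simp add: field_simps)
      then show ?thesis using False by (simp add: b_def)
    qed (simp add: b_def)
    then have "p / (exp 1 * L) * (1 - 1 / 20 * (ln L / L)) \<le> p / (exp 1 * L) * b"
      using p L23 by (intro mult_left_mono) auto
    also have "\<dots> \<le> bell_fun p \<beta> powr (1 / p)"
      using bell_fun_root_ge_no_correction[of p \<beta>] bell_fun_root_ge_small[of p \<beta>] p assms True
      by (auto simp: b_def L_def)
    finally show ?thesis by (simp add: L_def)
  qed
  then show ?thesis by (intro exI[of _ "1 / 20"]) auto
next
  case False
  \<comment> \<open>Now \<open>p / \<beta> \<ge> 2 / \<beta> > exp 1\<close>, so \<open>s\<close> is
    a positive lower bound for \<open>ln (ln (p / \<beta>))\<close>, uniform in \<open>p\<close>.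
    The error \<open>L / p \<le> 1 / (\<beta> * L)\<close> is then absorbed by the constant
    \<open>1 / (\<beta> * s)\<close>.\<close>
  define s where "s = ln (ln (2 / \<beta>))"
  have "exp 1 < 2 / \<beta>" using False assms by (simp add: field_simps)
  then have l0: "1 < ln (2 / \<beta>)" using assms ln_less_cancel_iff[of "exp 1" "2 / \<beta>"] by simp
  then have s: "s > 0" by (simp add: s_def)
  have "p / (exp 1 * ln (p / \<beta>)) * (1 - 1 / (\<beta> * s) * (ln (ln (p / \<beta>)) / ln (p / \<beta>)))
      \<le> bell_fun p \<beta> powr (1 / p)" if p: "p \<ge> 2" for p
  proof -
    define L where "L = ln (p / \<beta>)"
    have "ln (2 / \<beta>) \<le> L" unfolding L_def using p assms by (simp add: divide_right_mono)
    then have L1: "L > 1" and sL: "s \<le> ln L" using l0 by (auto simp: s_def)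
    have p': "p = \<beta> * exp L" using p assms by (simp add: L_def)
    have e2: "L\<^sup>2 \<le> exp L"
    proof -
      have "2 * (L\<^sup>2 + 1) \<le> exp 1 * (L\<^sup>2 + 1)"
        using exp_ge_add_one_self[of "1::real"] by (intro mult_right_mono) auto
      then show ?thesis using exp_ge_quadratic_at_one[of L] L1 by simp
    qed
    have "(L - ln L) / p \<le> L / p" using L1 p by (intro divide_right_mono) auto
    also have "L / p \<le> 1 / (\<beta> * L)"
      using e2 assms L1 by (simp add: p' field_simps power2_eq_square)
    also have "\<dots> \<le> 1 / (\<beta> * s) * (ln L / L)"
      using sL s assms L1 by (simp add: field_simps)
    finally have 1: "(L - ln L) / p \<le> 1 / (\<beta> * s) * (ln L / L)" .
    have "L \<le> exp L" using exp_ge_add_one_self[of L] by linarith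
    then have "\<beta> / p \<le> 1 / L"
      using assms L1 by (simp add: p' field_simps)
    also have "\<dots> \<le> (1 + ln L) / L" using L1 by (intro divide_right_mono) auto
    finally have "1 - 1 / (\<beta> * s) * (ln L / L) \<le> 1 + (1 + ln L) / L - (L - ln L) / p - \<beta> / p"
      using 1 by linarith
    then show ?thesis
      using p assms L1 unfolding L_def
      by (intro bell_fun_root_ge_large) (assumption | linarith)+
  qed
  then show ?thesis using s assms by (intro exI[of _ "1 / (\<beta> * s)"]) auto
qed

end
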